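(* Suppose $T\in\mathcal B(\mathcal H_n)$. Then $\sigma_S(T)$ is a non-empty compact subset of $\{s\in\mathbb R^{n+1}:0\le|s|\le\|T\|\}$.
   Context: Let $n\ge1$. $\mathbb R_n$ is the real Clifford algebra (of real dimension $2^n$) generated by $e_1,\dots,e_n$ with $e_i^2=-1$ and $e_ie_j=-e_je_i$ for $i\ne j$; it has basis $e_\alpha=e_{i_1}\cdots e_{i_r}$ for $\alpha=\{i_1<\cdots<i_r\}\subseteq\{1,\dots,n\}$, $e_\emptyset=1$. For $a=\sum_\alpha a_\alpha e_\alpha$ ($a_\alpha\in\mathbb R$): $\mathrm{Re}(a)=a_\emptyset$, $|a|=(\sum_\alpha a_\alpha^2)^{1/2}$. $\mathcal H$ is a real Hilbert space and $\mathcal H_n=\mathcal H\otimes\mathbb R_n$ is the two-sided Clifford module of elements $x=\sum_\alpha x_\alpha e_\alpha$ ($x_\alpha\in\mathcal H$) with norm $\|x\|=(\sum_\alpha\|x_\alpha\|^2)^{1/2}$. $\mathcal B(\mathcal H_n)$ is the set of everywhere defined right $\mathbb R_n$-linear operators on $\mathcal H_n$ with $\|T\|=\sup_{\|x\|\le1}\|Tx\|<\infty$. $\mathbb R^{n+1}$ is identified with the paravectors $s=s_0+\sum_{j=1}^n s_je_j\in\mathbb R_n$. With $\mathcal Q_s(T)=T^2-2\mathrm{Re}(s)T+|s|^2I$, the $S$-resolvent set $\rho_S(T)$ is the set of $s\in\mathbb R^{n+1}$ such that $\mathcal Q_s(T)$ has trivial kernel, dense range, and bounded inverse on its range; the $S$-spectrum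 is $\sigma_S(T)=\mathbb R^{n+1}\setminus\rho_S(T)$. *)

theory Defs
  imports "HOL-Analysis.Analysis"
begin

(* The generators are indexed by a finite linearly ordered type 'n with CARD('n) = n, so that
   subsets alpha of {1..n} become elements of 'n set.  An element of the Clifford algebra R_n is
   the vector of its coefficients, of type real ^ 'n set; an element of the Clifford module
   H (x) R_n is the vector of its components in H, of type 'h ^ 'n set.  The norms of these types
   are the Euclidean ones, i.e. the norms on R_n and on the module.
   Beware: the library's product * on real ^ 'n set is componentwise and is not the Clifford
   product. *)

(* e_alpha e_beta = cl_sign alpha beta * e_(sym_diff alpha beta): sorting the concatenated word
   costs a factor -1 for each pair i > j, and each common index contributes e_i ^ 2 = -1. *)
definition cl_sign :: "'n::{finite,linorder} set \<Rightarrow> 'n set \<Rightarrow> real" where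
  "cl_sign \<alpha> \<beta> = (\<Prod>i\<in>\<alpha>. \<Prod>j\<in>\<beta>. if j \<le> i then -1 else 1)"

definition cl_basis :: "'n::{finite,linorder} set \<Rightarrow> real ^ 'n set" where
  "cl_basis \<alpha> = axis \<alpha> 1"

(* The right action of R_n on the module, (sum x_alpha e_alpha) (sum a_beta e_beta)
   = sum (a_beta x_alpha) e_alpha e_beta.  For 'h = real it is the product of R_n. *)
definition cl_mult :: "'h::real_vector ^ 'n::{finite,linorder} set \<Rightarrow> real ^ 'n set \<Rightarrow> 'h ^ 'n set"
    (infixl \<open>\<odot>\<close> 70) where
  "x \<odot> a = (\<Sum>\<alpha>\<in>UNIV. \<Sum>\<beta>\<in>UNIV.
              axis (sym_diff \<alpha> \<beta>) ((cl_sign \<alpha> \<beta> * a $ \<beta>) *\<^sub>R x $ \<alpha>))"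

definition cl_Re :: "real ^ 'n::{finite,linorder} set \<Rightarrow> real" where
  "cl_Re a = a $ {}"

definition paravectors :: "(real ^ 'n::{finite,linorder} set) set" where
  "paravectors = {s. \<exists>s0 (v :: 'n \<Rightarrow> real). s = s0 *\<^sub>R cl_basis {} + (\<Sum>j\<in>UNIV. v j *\<^sub>R cl_basis {j})}"

definition clifford_bounded_ops ::
    "('h::real_normed_vector ^ 'n::{finite,linorder} set \<Rightarrow> 'h ^ 'n set) set" where
  "clifford_bounded_ops = {T. bounded_linear T \<and> (\<forall>x a. T (x \<odot> a) = T x \<odot> a)}"

definition Q_op :: "('h::real_normed_vector ^ 'n::{finite,linorder} set \<Rightarrow> 'h ^ 'n set) \<Rightarrow>
    real ^ 'n set \<Rightarrow> 'h ^ 'n set \<Rightarrow> 'h ^ 'n set" where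
  "Q_op T s x = T (T x) - (2 * cl_Re s) *\<^sub>R T x + (norm s)\<^sup>2 *\<^sub>R x"

definition S_resolvent_set ::
    "('h::real_normed_vector ^ 'n::{finite,linorder} set \<Rightarrow> 'h ^ 'n set) \<Rightarrow> (real ^ 'n set) set" where
  "S_resolvent_set T = {s \<in> paravectors.
     {x. Q_op T s x = 0} = {0} \<and>
     closure (range (Q_op T s)) = UNIV \<and>
     (\<exists>C. \<forall>y\<in>range (Q_op T s). norm (inv (Q_op T s) y) \<le> C * norm y)}"

definition S_spectrum ::
    "('h::real_normed_vector ^ 'n::{finite,linorder} set \<Rightarrow> 'h ^ 'n set) \<Rightarrow> (real ^ 'n set) set" where
  "S_spectrum T = paravectors - S_resolvent_set T"


(* The product above is that of the Clifford algebra: it is associative and unital, and the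
   cl_basis {i} satisfy the defining relations and have the cl_basis alpha as ordered products. *)

lemma cl_sign_empty [simp]: "cl_sign {} \<beta> = 1" "cl_sign \<alpha> {} = 1"
  by (simp_all add: cl_sign_def)

lemma prod_sym_diff:
  fixes f :: "'a::finite \<Rightarrow> real"
  assumes "\<And>i. f i * f i = 1"
  shows "prod f (sym_diff A B) = prod f A * prod f B"
proof -
  have sq: "prod f (A \<inter> B) * prod f (A \<inter> B) = 1"
    by (simp add: prod.distrib [symmetric] assms)
  have A: "prod f A = prod f (A - B) * prod f (A \<inter> B)"
    by (subst prod.union_disjoint [symmetric]) (auto intro!: prod.cong)
  have B: "prod f B = prod f (B - A) * prod f (A \<inter> B)"
    by (subst prod.union_disjoint [symmetric]) (auto intro!: prod.cong)
  have "prod f (sym_diff A B) = prod f (A - B) * prod f (B - A)"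
    by (rule prod.union_disjoint) auto
  also have "\<dots> = (prod f (A - B) * prod f (B - A)) * (prod f (A \<inter> B) * prod f (A \<inter> B))"
    by (simp add: sq)
  also have "\<dots> = prod f A * prod f B"
    unfolding A B by (simp add: mult_ac)
  finally show ?thesis .
qed

lemma cl_sign_sym_diff_left: "cl_sign (sym_diff \<alpha> \<beta>) \<gamma> = cl_sign \<alpha> \<gamma> * cl_sign \<beta> \<gamma>"
  unfolding cl_sign_def by (rule prod_sym_diff) (simp add: prod.distrib [symmetric] prod.neutral)

lemma cl_sign_sym_diff_right: "cl_sign \<alpha> (sym_diff \<beta> \<gamma>) = cl_sign \<alpha> \<beta> * cl_sign \<alpha> \<gamma>"
  unfolding cl_sign_def prod.distrib [symmetric]
  by (rule prod.cong [OF refl]) (rule prod_sym_diff, simp)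

lemma axis_add': "axis k (x + y) = axis k x + (axis k y :: 'a::monoid_add ^ 'n::finite)"
  by (simp add: vec_eq_iff axis_def)

lemma axis_sum: "axis k (sum f A) = (\<Sum>i\<in>A. axis k (f i) :: 'a::comm_monoid_add ^ 'n::finite)"
  by (simp add: vec_eq_iff axis_def)

lemma axis_scaleR': "axis k (r *\<^sub>R x) = r *\<^sub>R (axis k x :: 'a::real_vector ^ 'n::finite)"
  by (simp add: vec_eq_iff axis_def)

lemma vec_axis_decomp: "x = (\<Sum>\<alpha>\<in>UNIV. axis \<alpha> (x $ \<alpha>) :: 'a::comm_monoid_add ^ 'n::finite)"
  by (simp add: vec_eq_iff axis_def)

lemma cl_mult_add_left: "(x + y) \<odot> a = x \<odot> a + y \<odot> a"
  by (simp add: cl_mult_def scaleR_add_right axis_add' sum.distrib)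

lemma cl_mult_add_right: "x \<odot> (a + b) = x \<odot> a + x \<odot> b"
  by (simp add: cl_mult_def distrib_left scaleR_add_left axis_add' sum.distrib)

lemma cl_mult_scaleR_left: "(r *\<^sub>R x) \<odot> a = r *\<^sub>R (x \<odot> a)"
  by (simp add: cl_mult_def axis_scaleR' [symmetric] scaleR_sum_right mult_ac)

lemma cl_mult_scaleR_right: "x \<odot> (r *\<^sub>R a) = r *\<^sub>R (x \<odot> a)"
  by (simp add: cl_mult_def axis_scaleR' [symmetric] scaleR_sum_right mult_ac)

lemma cl_mult_sum_left: "sum f A \<odot> a = (\<Sum>i\<in>A. f i \<odot> a)"
  by (induction A rule: infinite_finite_induct)
     (simp_all add: cl_mult_add_left cl_mult_scaleR_left [of 0, simplified])

lemma cl_mult_sum_right: "x \<odot> sum f A = (\<Sum>i\<in>A. x \<odot> f i)"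
  by (induction A rule: infinite_finite_induct)
     (simp_all add: cl_mult_add_right cl_mult_scaleR_right [of _ 0, simplified])

lemma cl_mult_axis:
  "axis \<alpha> u \<odot> axis \<beta> r = axis (sym_diff \<alpha> \<beta>) ((cl_sign \<alpha> \<beta> * r) *\<^sub>R u)"
proof -
  have "axis \<alpha> u \<odot> axis \<beta> r
      = (\<Sum>\<alpha>'\<in>UNIV. \<Sum>\<beta>'\<in>UNIV. if \<beta>' = \<beta> then (if \<alpha>' = \<alpha> then
           axis (sym_diff \<alpha> \<beta>) ((cl_sign \<alpha> \<beta> * r) *\<^sub>R u) else 0) else 0)"
    unfolding cl_mult_def
    by (intro sum.cong refl) (auto simp: axis_def vec_eq_iff)
  then show ?thesis
    by simp
qed

lemma cl_basis_mult:
  "cl_basis \<alpha> \<odot> cl_basis \<beta> = cl_sign \<alpha> \<beta> *\<^sub>R cl_basis (sym_diff \<alpha> \<beta>)"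
  by (simp add: cl_basis_def cl_mult_axis axis_scaleR' [symmetric])

lemma cl_mult_assoc: "(x \<odot> a) \<odot> b = x \<odot> (a \<odot> b)"
proof -
  have sd: "sym_diff (sym_diff \<alpha> \<beta>) \<gamma> = sym_diff \<alpha> (sym_diff \<beta> \<gamma>)" for \<alpha> \<beta> \<gamma> :: "'b set"
    by blast
  have ax: "(axis \<alpha> u \<odot> axis \<beta> r) \<odot> axis \<gamma> t = axis \<alpha> u \<odot> (axis \<beta> r \<odot> axis \<gamma> t)"
    for \<alpha> \<beta> \<gamma> :: "'b set" and u :: 'a and r t
    unfolding cl_mult_axis sd cl_sign_sym_diff_left cl_sign_sym_diff_right
    by (simp add: mult_ac)
  show ?thesis
    by (subst (1 2) vec_axis_decomp [of x], subst (1 2) vec_axis_decomp [of a],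
        subst (1 2) vec_axis_decomp [of b])
       (simp only: cl_mult_sum_left cl_mult_sum_right ax)
qed

lemma cl_mult_one_right: "x \<odot> cl_basis {} = x"
proof -
  have "x \<odot> cl_basis {} = (\<Sum>\<alpha>\<in>UNIV. axis \<alpha> (x $ \<alpha>)) \<odot> cl_basis {}"
    by (simp only: vec_axis_decomp [symmetric])
  also have "\<dots> = (\<Sum>\<alpha>\<in>UNIV. axis \<alpha> (x $ \<alpha>))"
    unfolding cl_mult_sum_left cl_basis_def cl_mult_axis by simp
  finally show ?thesis
    by (simp only: vec_axis_decomp [symmetric])
qed

lemma cl_mult_one_left: "cl_basis {} \<odot> a = a"
proof -
  have "cl_basis {} \<odot> a = cl_basis {} \<odot> (\<Sum>\<alpha>\<in>UNIV. axis \<alpha> (a $ \<alpha>))"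
    by (simp only: vec_axis_decomp [symmetric])
  also have "\<dots> = (\<Sum>\<alpha>\<in>UNIV. axis \<alpha> (a $ \<alpha>))"
    unfolding cl_mult_sum_right cl_basis_def cl_mult_axis by simp
  finally show ?thesis
    by (simp only: vec_axis_decomp [symmetric])
qed

lemma cl_generator_square: "cl_basis {i} \<odot> cl_basis {i} = - cl_basis {}"
  by (simp add: cl_basis_mult cl_sign_def)

lemma cl_generators_anticommute:
  assumes "i \<noteq> j"
  shows "cl_basis {i} \<odot> cl_basis {j} = - (cl_basis {j} \<odot> cl_basis {i})"
proof -
  have "sym_diff {i} {j} = sym_diff {j} {i}"
    by blast
  with assms show ?thesis
    by (auto simp: cl_basis_mult cl_sign_def)
qed

lemma cl_basis_insert:
  assumes "\<And>j. j \<in> \<alpha> \<Longrightarrow> i < j"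
  shows "cl_basis {i} \<odot> cl_basis \<alpha> = cl_basis (insert i \<alpha>)"
proof -
  have "sym_diff {i} \<alpha> = insert i \<alpha>"
    using assms by auto
  moreover have "cl_sign {i} \<alpha> = 1"
    using assms by (simp add: cl_sign_def prod.neutral flip: not_less)
  ultimately show ?thesis
    by (simp add: cl_basis_mult)
qed

end

theory Submission
  imports Defs "HOL-Complex_Analysis.Cauchy_Integral_Formula"
begin

text \<open>
  On the complexification \<open>X \<times> X\<close> of the real Hilbert space \<open>X\<close> the operator
  \<open>Q\<^sub>s(T) \<times> Q\<^sub>s(T)\<close> factors as \<open>(T - z)(T - z\<^sup>*)\<close>, where \<open>z\<close> is a complex number with the same real part
  and modulus as \<open>s\<close>. Hence the S-spectrum is described by the complex spectrum of \<open>T\<close>. A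
  perturbation argument via the Banach fixed point theorem shows that it is closed and contained in
  the ball of radius \<open>\<parallel>T\<parallel>\<close>. If it were empty, the matrix coefficients of the
  resolvent would be entire and vanish at infinity, hence be zero by Liouville's theorem.
\<close>

section \<open>Boundedly invertible operators and their perturbations\<close>

text \<open>Expresses invertibility with inverse of norm at most \<open>1 / c\<close> without naming
  the inverse; the explicit constant measures how large a perturbation is tolerated.\<close>

definition surj_expanding :: "real \<Rightarrow> ('a::real_normed_vector \<Rightarrow> 'b::real_normed_vector) \<Rightarrow> bool" where
  "surj_expanding c B \<longleftrightarrow> 0 < c \<and> bounded_linear B \<and> surj B \<and> (\<forall>x. c * norm x \<le> norm (B x))"

lemma inj_if_bounded_below:
  assumes "bounded_linear B" "0 < c" "\<And>x. c * norm x \<le> norm (B x)"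
  shows "inj B"
proof -
  interpret bounded_linear B by fact
  have "x = 0" if "B x = 0" for x
    using assms(2) assms(3)[of x] that by (simp add: mult_le_0_iff)
  then show ?thesis
    by (simp add: linear_injective_0[OF linear_axioms])
qed

lemma surj_expanding_bij:
  assumes "surj_expanding c B"
  shows "bij B"
  using assms inj_if_bounded_below[of B c] by (simp add: surj_expanding_def bij_def)

lemma surj_expanding_norm_inv_le:
  assumes "surj_expanding c B"
  shows "norm (inv B y) \<le> norm y / c"
proof -
  have "B (inv B y) = y"
    using assms by (simp add: surj_expanding_def surj_f_inv_f)
  moreover have "c * norm (inv B y) \<le> norm (B (inv B y))" "0 < c"
    using assms by (simp_all only: surj_expanding_def)
  ultimately show ?thesis
    by (simp add: field_simps)
qed

lemma surj_expanding_compose: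
  assumes B: "surj_expanding b B" and C: "surj_expanding c C"
  shows "surj_expanding (b * c) (\<lambda>x. B (C x))"
proof -
  have "b * c * norm x \<le> norm (B (C x))" for x
  proof -
    have "b * (c * norm x) \<le> b * norm (C x)"
      using assms by (intro mult_left_mono) (auto simp: surj_expanding_def)
    also have "\<dots> \<le> norm (B (C x))"
      using B by (simp add: surj_expanding_def)
    finally show ?thesis by (simp add: mult.assoc)
  qed
  moreover have "surj (\<lambda>x. B (C x))"
    using comp_surj[of C B] assms by (simp add: surj_expanding_def comp_def)
  ultimately show ?thesis
    using assms by (auto simp: surj_expanding_def intro: bounded_linear_compose)
qed

text \<open>The lower bound is the triangle inequality. For surjectivity, solving
  \<open>B x + P x = y\<close> means finding a fixed point of \<open>inv B (y - P x)\<close>, a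
  contraction with factor \<open>d / c\<close>.\<close>

lemma surj_expanding_perturb:
  fixes B P :: "'a::{real_normed_vector, complete_space} \<Rightarrow> 'b::real_normed_vector"
  assumes B: "surj_expanding c B" and P: "bounded_linear P"
    and P_le: "\<And>x. norm (P x) \<le> d * norm x" and d: "0 \<le> d" "d < c"
  shows "surj_expanding (c - d) (\<lambda>x. B x + P x)"
proof -
  interpret B: bounded_linear B using B by (simp add: surj_expanding_def)
  interpret P: bounded_linear P by fact
  have c: "0 < c" and surj: "surj B" and B_ge: "\<And>x. c * norm x \<le> norm (B x)"
    using B by (auto simp: surj_expanding_def)
  have "(c - d) * norm x \<le> norm (B x + P x)" for x
    using B_ge[of x] P_le[of x] norm_diff_ineq[of "B x" "P x"] by (simp add: algebra_simps)
  moreover have "\<exists>x. y = B x + P x" for y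
  proof -
    define f where "f x = inv B (y - P x)" for x
    have Bf: "B (f x) = y - P x" for x
      using surj by (simp add: f_def surj_f_inv_f)
    have "dist (f x) (f x') \<le> d / c * dist x x'" for x x'
    proof -
      have "c * norm (f x - f x') \<le> norm (B (f x) - B (f x'))"
        using B_ge[of "f x - f x'"] by (simp add: B.diff)
      also have "\<dots> = norm (P (x' - x))"
        by (simp add: Bf P.diff)
      also have "\<dots> \<le> d * norm (x - x')"
        using P_le[of "x' - x"] by (simp add: norm_minus_commute)
      finally show ?thesis
        using c by (simp add: dist_norm field_simps)
    qed
    then obtain x where "f x = x"
      using banach_fix_type[of "d / c" f] c d by auto
    with Bf[of x] show ?thesis by (intro exI[of _ x]) simp
  qed
  then have "surj (\<lambda>x. B x + P x)"
    by (simp add: surj_def)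
  ultimately show ?thesis
    using d B.bounded_linear_axioms P by (simp add: surj_expanding_def bounded_linear_add)
qed

text \<open>The lower bound makes preimages of a convergent sequence Cauchy, so by completeness of
  the domain the range is closed. This turns the dense range demanded by the S-resolvent set into
  surjectivity.\<close>

lemma surj_if_bounded_below_dense_range:
  fixes B :: "'a::{real_normed_vector, complete_space} \<Rightarrow> 'b::real_normed_vector"
  assumes B: "bounded_linear B" and c: "0 < c" and B_ge: "\<And>x. c * norm x \<le> norm (B x)"
    and dense: "closure (range B) = UNIV"
  shows "surj B"
proof -
  interpret bounded_linear B by fact
  have "y \<in> range B" for y
  proof -
    have "y \<in> closure (range B)" using dense by simp
    then obtain f where f: "\<And>n. f n \<in> range B" "f \<longlonglongrightarrow> y"
      by (auto simp: closure_sequential)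
    then have "\<forall>n. \<exists>x. f n = B x"
      by blast
    then obtain g where g: "\<And>n. f n = B (g n)"
      by metis
    have "Cauchy g"
    proof (rule CauchyI)
      fix e :: real assume "0 < e"
      have "Cauchy f" using f(2) by (rule LIMSEQ_imp_Cauchy)
      then obtain M where M: "\<And>m n. M \<le> m \<Longrightarrow> M \<le> n \<Longrightarrow> norm (f m - f n) < c * e"
        using CauchyD[of f "c * e"] c \<open>0 < e\<close> by auto
      have "norm (g m - g n) < e" if "M \<le> m" "M \<le> n" for m n
      proof -
        have "c * norm (g m - g n) \<le> norm (f m - f n)"
          using B_ge[of "g m - g n"] by (simp add: g diff)
        also have "\<dots> < c * e" using M that by simp
        finally show ?thesis using c by simp
      qed
      then show "\<exists>M. \<forall>m\<ge>M. \<forall>n\<ge>M. norm (g m - g n) < e" by blast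
    qed
    then obtain x where "g \<longlonglongrightarrow> x"
      using Cauchy_convergent convergent_def by blast
    then have "f \<longlonglongrightarrow> B x"
      using tendsto g by (simp add: g[abs_def])
    with f(2) have "y = B x" by (rule LIMSEQ_unique)
    then show ?thesis by simp
  qed
  then show ?thesis by auto
qed

section \<open>The complexification of a real inner product space\<close>

text \<open>Complex scalar multiplication, where the pair \<open>(u, v)\<close> stands for u +
  iv.\<close>

definition cscale :: "complex \<Rightarrow> 'a::real_vector \<times> 'a \<Rightarrow> 'a \<times> 'a" where
  "cscale z p = (Re z *\<^sub>R fst p - Im z *\<^sub>R snd p, Im z *\<^sub>R fst p + Re z *\<^sub>R snd p)"

lemma cscale_diff_left: "cscale (z - w) p = cscale z p - cscale w p"
  by (simp add: cscale_def algebra_simps)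

text \<open>The product norm is Euclidean, and the mixed terms cancel by symmetry of the real inner
  product.\<close>

lemma norm_cscale:
  fixes p :: "'a::real_inner \<times> 'a"
  shows "norm (cscale z p) = cmod z * norm p"
proof -
  have "(norm (cscale z p))\<^sup>2 = (cmod z * norm p)\<^sup>2"
    unfolding power_mult_distrib cmod_power2 power2_norm_eq_inner cscale_def
    by (cases p) (simp add: inner_Pair algebra_simps inner_commute power2_eq_square)
  then show ?thesis
    by (simp add: power2_eq_iff_nonneg)
qed

lemma bounded_linear_cscale: "bounded_linear (cscale z :: 'a::real_inner \<times> 'a \<Rightarrow> _)"
  by (rule bounded_linear_intro[of _ "cmod z"])
     (simp_all add: norm_cscale, simp_all add: cscale_def algebra_simps)

lemma cscale_cscale: "cscale z (cscale w p) = cscale (z * w) p"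
  by (simp add: cscale_def algebra_simps)

lemma surj_expanding_cscale:
  assumes "z \<noteq> 0"
  shows "surj_expanding (cmod z) (cscale z :: 'a::real_inner \<times> 'a \<Rightarrow> _)"
proof -
  have "cscale z (cscale (inverse z) p) = p" for p :: "'a \<times> 'a"
    using assms by (simp add: cscale_cscale) (simp add: cscale_def)
  then have "surj (cscale z :: 'a \<times> 'a \<Rightarrow> _)"
    by (rule surjI)
  with assms show ?thesis
    by (simp add: surj_expanding_def bounded_linear_cscale norm_cscale)
qed

text \<open>The inner product of u + iv with a real vector, complex linear in the first argument.
  Real test vectors suffice to separate points.\<close>

definition cpair :: "'a::real_inner \<times> 'a \<Rightarrow> 'a \<Rightarrow> complex" where
  "cpair p y = Complex (fst p \<bullet> y) (snd p \<bullet> y)"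

lemma cpair_cscale: "cpair (cscale z p) y = z * cpair p y"
  by (simp add: cpair_def cscale_def complex_eq_iff algebra_simps)

lemma cpair_diff: "cpair (p - q) y = cpair p y - cpair q y"
  by (simp add: cpair_def complex_eq_iff algebra_simps)

lemma norm_cpair_le: "cmod (cpair p y) \<le> 2 * norm y * norm p"
proof -
  have "cmod (cpair p y) \<le> \<bar>fst p \<bullet> y\<bar> + \<bar>snd p \<bullet> y\<bar>"
    using cmod_le[of "cpair p y"] by (simp add: cpair_def)
  also have "\<dots> \<le> norm (fst p) * norm y + norm (snd p) * norm y"
    by (intro add_mono Cauchy_Schwarz_ineq2)
  also have "\<dots> \<le> norm p * norm y + norm p * norm y"
    using norm_fst_le[of "fst p" "snd p"] norm_snd_le[of "snd p" "fst p"]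
    by (intro add_mono mult_right_mono) simp_all
  finally show ?thesis by (simp add: algebra_simps)
qed

lemma tendsto_cpair:
  assumes "(f \<longlongrightarrow> p) F"
  shows "((\<lambda>x. cpair (f x) y) \<longlongrightarrow> cpair p y) F"
  unfolding cpair_def by (intro tendsto_intros assms)

section \<open>Factorization of the quadratic operator and invertibility of its factors\<close>

text \<open>\<open>Q_op T s\<close> depends on \<open>s\<close> only through its real part and norm,
  so a complex number can take the place of the paravector.\<close>

definition quad_op :: "('a::real_vector \<Rightarrow> 'a) \<Rightarrow> complex \<Rightarrow> 'a \<Rightarrow> 'a" where
  "quad_op T z x = T (T x) - (2 * Re z) *\<^sub>R T x + (cmod z)\<^sup>2 *\<^sub>R x"

text \<open>This is T - z on the complexification, with \<open>map_prod T T\<close> the complexified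
  operator.\<close>

definition cshift :: "('a::real_vector \<Rightarrow> 'a) \<Rightarrow> complex \<Rightarrow> 'a \<times> 'a \<Rightarrow> 'a \<times> 'a" where
  "cshift T z p = map_prod T T p - cscale z p"

lemma quad_op_cnj: "quad_op T (cnj z) = quad_op T z"
  by (simp add: quad_op_def fun_eq_iff)

lemma bounded_linear_quad_op:
  assumes "bounded_linear T"
  shows "bounded_linear (quad_op T z)"
  unfolding quad_op_def
  by (intro bounded_linear_intros bounded_linear_compose[OF assms] assms)

context
  fixes T :: "'a::{real_inner, complete_space} \<Rightarrow> 'a"
  assumes T: "bounded_linear T"
begin

interpretation T: bounded_linear T by (rule T)

lemma bounded_linear_map_prod: "bounded_linear (map_prod T T)"
  unfolding map_prod_def case_prod_unfold
  by (intro bounded_linear_Pair bounded_linear_compose[OF T] bounded_linear_fst bounded_linear_snd)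

lemma norm_map_prod_le: "norm (map_prod T T p) \<le> onorm T * norm p"
proof -
  have le: "(norm (T u))\<^sup>2 \<le> (onorm T)\<^sup>2 * (norm u)\<^sup>2" for u
    using power_mono[OF onorm[OF T, of u] norm_ge_zero, of 2] by (simp add: power_mult_distrib)
  have "(norm (map_prod T T p))\<^sup>2 \<le> (onorm T * norm p)\<^sup>2"
    using le[of "fst p"] le[of "snd p"]
    by (cases p) (simp add: norm_Pair power_mult_distrib distrib_left)
  then show ?thesis
    using onorm_pos_le[OF T] by (simp add: abs_le_square_iff[symmetric])
qed

lemma bounded_linear_cshift: "bounded_linear (cshift T z)"
  unfolding cshift_def
  by (intro bounded_linear_sub bounded_linear_map_prod bounded_linear_cscale)

text \<open>\<open>T\<close> is real linear, so its complexification commutes with complex scalars;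
  the rest is that z and its conjugate have sum \<open>2 * Re z\<close> and product
  \<open>(cmod z)\<^sup>2\<close>.\<close>

lemma cshift_cshift_cnj: "cshift T z (cshift T (cnj z) p) = map_prod (quad_op T z) (quad_op T z) p"
proof -
  have "quad_op T z x =
      T (T x) - (Re z *\<^sub>R T x + Re z *\<^sub>R T x) + ((Re z * Re z) *\<^sub>R x + (Im z * Im z) *\<^sub>R x)" for x
    unfolding quad_op_def cmod_power2
    by (simp add: power2_eq_square scaleR_add_left flip: scaleR_2)
  then show ?thesis
    by (cases p) (simp add: cshift_def cscale_def T.diff T.add T.scaleR T.neg algebra_simps)
qed

text \<open>The two factors commute: with \<open>cshift T z\<close> as inner factor the product
  gives the lower bound, with it as outer factor the surjectivity.\<close>

lemma surj_expanding_cshift_if_quad_op: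
  assumes Q: "surj_expanding c (quad_op T z)"
  shows "\<exists>c. surj_expanding c (cshift T z)"
proof -
  have c: "0 < c" and surj: "surj (quad_op T z)"
    and Q_ge: "\<And>x. c * norm x \<le> norm (quad_op T z x)"
    using Q by (auto simp: surj_expanding_def)
  have fac': "cshift T (cnj z) (cshift T z p) = map_prod (quad_op T z) (quad_op T z) p" for p
    using cshift_cshift_cnj[of "cnj z" p] by (simp add: quad_op_cnj)
  obtain K where K: "0 < K" "\<And>p. norm (cshift T (cnj z) p) \<le> norm p * K"
    using bounded_linear.pos_bounded[OF bounded_linear_cshift] by blast
  have "c / K * norm p \<le> norm (cshift T z p)" for p
  proof -
    have "(c * norm p)\<^sup>2 \<le> (norm (map_prod (quad_op T z) (quad_op T z) p))\<^sup>2"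
      using power_mono[OF Q_ge[of "fst p"], of 2] power_mono[OF Q_ge[of "snd p"], of 2] c
      by (cases p) (simp add: norm_Pair power_mult_distrib distrib_left)
    then have "c * norm p \<le> norm (map_prod (quad_op T z) (quad_op T z) p)"
      by (rule power2_le_imp_le) simp
    also have "\<dots> \<le> norm (cshift T z p) * K"
      using K(2)[of "cshift T z p"] by (simp add: fac')
    finally show ?thesis using K(1) by (simp add: field_simps)
  qed
  moreover have "surj (map_prod (quad_op T z) (quad_op T z))"
    by (intro map_prod_surj surj)
  then have "surj (cshift T z \<circ> cshift T (cnj z))"
    by (simp add: comp_def cshift_cshift_cnj)
  then have "surj (cshift T z)"
    unfolding image_comp[symmetric] by blast
  ultimately show ?thesis
    using c K(1) bounded_linear_cshift
    by (intro exI[of _ "c / K"]) (simp add: surj_expanding_def)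
qed

text \<open>The product of the factors acts as \<open>quad_op T z\<close> on each component, so it
  is enough to look at pairs \<open>(x, 0)\<close> and at preimages of
  \<open>(y, 0)\<close>.\<close>

lemma surj_expanding_quad_op_if_cshift:
  assumes "surj_expanding b (cshift T z)" "surj_expanding c (cshift T (cnj z))"
  shows "surj_expanding (b * c) (quad_op T z)"
proof -
  have QQ: "surj_expanding (b * c) (map_prod (quad_op T z) (quad_op T z))"
    using surj_expanding_compose[OF assms] by (simp add: cshift_cshift_cnj)
  have "b * c * norm x \<le> norm (quad_op T z x)" for x
  proof -
    have "b * c * norm (x, 0::'a) \<le> norm (map_prod (quad_op T z) (quad_op T z) (x, 0))"
      using QQ unfolding surj_expanding_def by blast
    also have "\<dots> = norm (quad_op T z x)"
      by (simp add: norm_Pair quad_op_def T.zero)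
    finally show ?thesis by (simp add: norm_Pair)
  qed
  moreover have "surj (quad_op T z)"
  proof -
    have "\<exists>x. y = quad_op T z x" for y
    proof -
      obtain p where "(y, 0) = map_prod (quad_op T z) (quad_op T z) p"
        using QQ unfolding surj_expanding_def surj_def by blast
      then show ?thesis by (cases p) auto
    qed
    then show ?thesis by (simp add: surj_def)
  qed
  ultimately show ?thesis
    using QQ bounded_linear_quad_op[OF T] by (simp add: surj_expanding_def)
qed

text \<open>T - z is a perturbation of the scalar -z by T. The constant gives the Neumann series
  bound on the resolvent, used both to locate the spectrum and for decay at infinity.\<close>

lemma surj_expanding_cshift_large:
  assumes "onorm T < cmod z"
  shows "surj_expanding (cmod z - onorm T) (cshift T z)"
proof -
  have "z \<noteq> 0" using assms onorm_pos_le[OF T] by auto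
  then have "surj_expanding (cmod (- z)) (cscale (- z) :: 'a \<times> 'a \<Rightarrow> _)"
    by (intro surj_expanding_cscale) simp
  then have "surj_expanding (cmod (- z) - onorm T) (\<lambda>p. cscale (- z) p + map_prod T T p)"
    using assms onorm_pos_le[OF T]
    by (intro surj_expanding_perturb bounded_linear_map_prod norm_map_prod_le) auto
  moreover have "(\<lambda>p. cscale (- z) p + map_prod T T p) = cshift T z"
    by (auto simp: cshift_def cscale_def)
  ultimately show ?thesis by simp
qed

lemma surj_expanding_quad_op_large:
  assumes "onorm T < cmod z"
  shows "\<exists>c. surj_expanding c (quad_op T z)"
  using assms surj_expanding_quad_op_if_cshift surj_expanding_cshift_large[of z]
    surj_expanding_cshift_large[of "cnj z"] by auto

text \<open>Non-emptiness of the complex spectrum, by Liouville's theorem applied to matrix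
  coefficients of the resolvent \<open>R\<close>. A nonzero vector is required: on the zero space
  every operator is invertible.\<close>

lemma ex_not_surj_expanding_cshift:
  assumes "\<exists>u::'a. u \<noteq> 0"
  shows "\<exists>z. \<forall>c. \<not> surj_expanding c (cshift T z)"
proof (rule ccontr)
  assume "\<not> ?thesis"
  then obtain c where c: "\<And>z. surj_expanding (c z) (cshift T z)"
    by metis
  define R where "R z = inv (cshift T z)" for z
  have c_pos: "0 < c z" for z
    using c by (simp add: surj_expanding_def)
  have shift_R [simp]: "cshift T z (R z p) = p" for z p
    using surj_expanding_bij[OF c] by (simp add: R_def bij_is_surj surj_f_inv_f)
  have R_shift: "R z (cshift T z p) = p" for z p
    using surj_expanding_bij[OF c] by (simp add: R_def bij_is_inj)
  have shift_diff: "cshift T z (p - q) = cshift T z p - cshift T z q" for z p q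
    by (rule linear_diff[OF bounded_linear.linear[OF bounded_linear_cshift]])
  have shift_cscale: "cshift T z (cscale w p) = cscale w (cshift T z p)" for z w p
    by (cases p) (simp add: cshift_def cscale_def T.diff T.add T.scaleR algebra_simps)
  \<comment> \<open>The first resolvent identity, checked after applying the injective map
    \<open>cshift T w\<close> to both sides.\<close>
  have resolvent_identity: "R w p - R z p = cscale (w - z) (R w (R z p))" for w z p
  proof -
    have "cshift T w (R w p - R z p) = p - cshift T w (R z p)"
      by (simp add: shift_diff)
    also have "\<dots> = cshift T z (R z p) - cshift T w (R z p)"
      by simp
    also have "\<dots> = cscale (w - z) (R z p)"
      by (simp add: cshift_def cscale_diff_left del: shift_R)
    also have "\<dots> = cshift T w (cscale (w - z) (R w (R z p)))"
      by (simp add: shift_cscale)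
    finally have "R w (cshift T w (R w p - R z p)) = R w (cshift T w (cscale (w - z) (R w (R z p))))"
      by (rule arg_cong)
    then show ?thesis
      by (simp only: R_shift)
  qed
  \<comment> \<open>Strong continuity of the resolvent. The constants \<open>c w\<close> were chosen
    without any control in \<open>w\<close>, so the bound on \<open>R w\<close> near
    \<open>z\<close> comes from perturbing \<open>cshift T z\<close>.\<close>
  have R_tendsto: "((\<lambda>w. R w p) \<longlongrightarrow> R z p) (at z)" for z p
  proof -
    have bound: "norm (R w p - R z p) \<le> cmod (w - z) * (norm (R z p) / (c z - cmod (w - z)))"
      if "cmod (w - z) < c z" for w
    proof -
      have "surj_expanding (c z - cmod (w - z)) (\<lambda>p. cshift T z p + cscale (z - w) p)"
        by (rule surj_expanding_perturb[OF c bounded_linear_cscale])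
           (use that in \<open>auto simp: norm_cscale norm_minus_commute\<close>)
      moreover have "(\<lambda>p. cshift T z p + cscale (z - w) p) = cshift T w"
        by (auto simp: cshift_def cscale_diff_left)
      ultimately have "surj_expanding (c z - cmod (w - z)) (cshift T w)"
        by simp
      from surj_expanding_norm_inv_le[OF this, of "R z p"]
      have "norm (R w (R z p)) \<le> norm (R z p) / (c z - cmod (w - z))"
        by (simp add: R_def)
      then show ?thesis
        unfolding resolvent_identity norm_cscale by (rule mult_left_mono) simp
    qed
    have "((\<lambda>w. cmod (w - z) * (norm (R z p) / (c z - cmod (w - z)))) \<longlongrightarrow>
        cmod (z - z) * (norm (R z p) / (c z - cmod (z - z)))) (at z)"
      using c_pos[of z] by (intro tendsto_intros) auto
    then have "((\<lambda>w. cmod (w - z) * (norm (R z p) / (c z - cmod (w - z)))) \<longlongrightarrow> 0) (at z)"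
      by simp
    moreover have "\<forall>\<^sub>F w in at z. cmod (w - z) < c z"
      using c_pos[of z] by (auto simp: eventually_at dist_norm)
    then have "\<forall>\<^sub>F w in at z. norm (R w p - R z p) \<le>
        cmod (w - z) * (norm (R z p) / (c z - cmod (w - z)))"
      by (rule eventually_mono) (rule bound)
    ultimately have "((\<lambda>w. R w p - R z p) \<longlongrightarrow> 0) (at z)"
      by (rule Lim_null_comparison[rotated])
    then show ?thesis
      by (simp add: LIM_zero_iff)
  qed
  have coeff_zero: "cpair (R z p) y = 0" for z p y
  proof (rule Liouville_weak[where f = "\<lambda>z. cpair (R z p) y"])
    show "(\<lambda>z. cpair (R z p) y) holomorphic_on UNIV"
    proof (rule holomorphic_onI)
      fix z
      \<comment> \<open>By the resolvent identity the difference quotient is the coefficient of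
        \<open>R w (R z p)\<close>, and strong continuity at the vector \<open>R z p\<close> gives
        its limit.\<close>
      have "((\<lambda>w. (cpair (R w p) y - cpair (R z p) y) / (w - z)) \<longlongrightarrow> cpair (R z (R z p)) y) (at z)"
      proof (rule Lim_transform_eventually)
        show "((\<lambda>w. cpair (R w (R z p)) y) \<longlongrightarrow> cpair (R z (R z p)) y) (at z)"
          by (intro tendsto_cpair R_tendsto)
        show "\<forall>\<^sub>F w in at z. cpair (R w (R z p)) y = (cpair (R w p) y - cpair (R z p) y) / (w - z)"
          by (auto simp: eventually_at_filter cpair_diff[symmetric] resolvent_identity cpair_cscale)
      qed
      then show "(\<lambda>z. cpair (R z p) y) field_differentiable at z within UNIV"
        by (auto simp: field_differentiable_def has_field_derivative_iff)
    qed
    show "((\<lambda>z. cpair (R z p) y) \<longlongrightarrow> 0) at_infinity"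
    proof (rule Lim_null_comparison[where g = "\<lambda>z. 2 * norm y * (norm p / (cmod z - onorm T))"])
      show "\<forall>\<^sub>F z in at_infinity. cmod (cpair (R z p) y) \<le> 2 * norm y * (norm p / (cmod z - onorm T))"
        unfolding eventually_at_infinity
      proof (intro exI[of _ "onorm T + 1"] allI impI)
        fix z :: complex
        assume "onorm T + 1 \<le> cmod z"
        then have "norm (R z p) \<le> norm p / (cmod z - onorm T)"
          unfolding R_def by (intro surj_expanding_norm_inv_le surj_expanding_cshift_large) simp
        then show "cmod (cpair (R z p) y) \<le> 2 * norm y * (norm p / (cmod z - onorm T))"
          by (intro order_trans[OF norm_cpair_le] mult_left_mono) auto
      qed
      have "filterlim (\<lambda>z. - onorm T + cmod z) at_top at_infinity"
        by (intro filterlim_tendsto_add_at_top[OF tendsto_const] filterlim_norm_at_top)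
      then have "((\<lambda>z. 2 * norm y * (norm p / (- onorm T + cmod z))) \<longlongrightarrow> 2 * norm y * 0) at_infinity"
        by (intro tendsto_mult tendsto_const tendsto_divide_0[OF tendsto_const] filterlim_at_top_imp_at_infinity)
      then show "((\<lambda>z. 2 * norm y * (norm p / (cmod z - onorm T))) \<longlongrightarrow> 0) at_infinity"
        by simp
    qed
  qed
  obtain u :: 'a where "u \<noteq> 0" using assms by blast
  define p where "p = R 0 (u, 0)"
  \<comment> \<open>Testing \<open>p\<close> against its own components makes their squared norms
    vanish.\<close>
  have "fst p = 0" "snd p = 0"
    using coeff_zero[of 0 "(u, 0)" "fst p"] coeff_zero[of 0 "(u, 0)" "snd p"]
    by (simp_all add: p_def[symmetric] cpair_def complex_eq_iff)
  then have "p = 0" by (simp add: prod_eq_iff)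
  then have "(u, 0) = cshift T 0 0"
    using shift_R[of 0 "(u, 0)"] by (simp add: p_def)
  with \<open>u \<noteq> 0\<close> show False
    by (simp add: cshift_def cscale_def T.zero zero_prod_def)
qed

end

section \<open>Paravectors and complex numbers with equal real part and modulus\<close>

text \<open>Serves to show that the paravectors are closed, as a subspace of a finite-dimensional
  space.\<close>

lemma subspace_paravectors: "subspace (paravectors :: (real ^ 'n::{finite,linorder} set) set)"
proof (rule subspaceI)
  show "0 \<in> (paravectors :: (real ^ 'n set) set)"
    unfolding paravectors_def by (intro CollectI exI[of _ 0] exI[of _ "\<lambda>_. 0"]) simp
next
  fix s t :: "real ^ 'n set"
  assume "s \<in> paravectors" "t \<in> paravectors"
  then obtain s0 t0 and v w :: "'n \<Rightarrow> real" where
    "s = s0 *\<^sub>R cl_basis {} + (\<Sum>j\<in>UNIV. v j *\<^sub>R cl_basis {j})"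
    "t = t0 *\<^sub>R cl_basis {} + (\<Sum>j\<in>UNIV. w j *\<^sub>R cl_basis {j})"
    unfolding paravectors_def by blast
  then show "s + t \<in> paravectors"
    unfolding paravectors_def
    by (intro CollectI exI[of _ "s0 + t0"] exI[of _ "\<lambda>j. v j + w j"])
       (simp add: algebra_simps sum.distrib)
next
  fix r and s :: "real ^ 'n set"
  assume "s \<in> paravectors"
  then obtain s0 and v :: "'n \<Rightarrow> real" where
    "s = s0 *\<^sub>R cl_basis {} + (\<Sum>j\<in>UNIV. v j *\<^sub>R cl_basis {j})"
    unfolding paravectors_def by blast
  then show "r *\<^sub>R s \<in> paravectors"
    unfolding paravectors_def
    by (intro CollectI exI[of _ "r * s0"] exI[of _ "\<lambda>j. r * v j"])
       (simp add: algebra_simps scaleR_sum_right)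
qed

lemma Q_op_eq_quad_op:
  assumes "Re z = cl_Re s" "cmod z = norm s"
  shows "Q_op T s = quad_op T z"
  using assms by (simp add: Q_op_def quad_op_def fun_eq_iff)

text \<open>The scalar coefficient is at most the norm in absolute value, so the imaginary part can
  be the square root of the difference of squares.\<close>

lemma ex_complex_Re_norm: "\<exists>z. Re z = cl_Re s \<and> cmod z = norm s"
proof -
  have "(cl_Re s)\<^sup>2 \<le> (norm s)\<^sup>2"
    using component_le_norm_cart[of s "{}"] by (simp add: cl_Re_def abs_le_square_iff[symmetric])
  then show ?thesis
    by (intro exI[of _ "Complex (cl_Re s) (sqrt ((norm s)\<^sup>2 - (cl_Re s)\<^sup>2))"]) (simp add: cmod_def)
qed

lemma ex_paravector_Re_norm:
  "\<exists>s\<in>paravectors. cl_Re s = Re z \<and> norm (s :: real ^ 'n::{finite,linorder} set) = cmod z"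
proof -
  \<comment> \<open>Any generator will do; one exists because types are nonempty, which encodes n
    \<ge> 1.\<close>
  define j :: 'n where "j = undefined"
  define s :: "real ^ 'n set" where "s = Re z *\<^sub>R cl_basis {} + Im z *\<^sub>R cl_basis {j}"
  have "(\<Sum>i\<in>UNIV. (if i = j then Im z else 0) *\<^sub>R (cl_basis {i} :: real ^ 'n set)) = Im z *\<^sub>R cl_basis {j}"
    by (subst sum.remove[of _ j]) auto
  then have "s \<in> paravectors"
    unfolding paravectors_def s_def
    by (intro CollectI exI[of _ "Re z"] exI[of _ "\<lambda>i. if i = j then Im z else 0"]) simp
  moreover have "cl_Re s = Re z"
    by (simp add: s_def cl_Re_def cl_basis_def axis_def)
  moreover have "(norm s)\<^sup>2 = (cmod z)\<^sup>2"
    unfolding s_def cl_basis_def cmod_power2 power2_norm_eq_inner[of "_ :: real ^ 'n set"]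
    by (simp add: inner_add_left inner_add_right inner_axis_axis power2_eq_square)
  then have "norm s = cmod z"
    by (simp add: power2_eq_iff_nonneg)
  ultimately show ?thesis by blast
qed

section \<open>The S-resolvent set: characterization and openness\<close>

context
  fixes T :: "'h::{real_inner, complete_space} ^ 'n::{finite, linorder} set \<Rightarrow> 'h ^ 'n set"
  assumes T: "bounded_linear T"
begin

interpretation T: bounded_linear T by (rule T)

text \<open>A trivial kernel makes \<open>inv\<close> a genuine left inverse, so its bound on the
  range becomes a lower bound for \<open>Q_op T s\<close>; completeness and the dense range then
  give surjectivity.\<close>

lemma S_resolvent_set_iff:
  "s \<in> S_resolvent_set T \<longleftrightarrow> s \<in> paravectors \<and> (\<exists>c. surj_expanding c (Q_op T s))"
proof (intro iffI conjI; (elim conjE exE)?)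
  assume s: "s \<in> S_resolvent_set T"
  then show "s \<in> paravectors"
    by (simp add: S_resolvent_set_def)
  have Q: "bounded_linear (Q_op T s)"
    using ex_complex_Re_norm[of s] Q_op_eq_quad_op[of _ s T] bounded_linear_quad_op[OF T] by metis
  interpret Q: bounded_linear "Q_op T s" by (rule Q)
  have inj: "inj (Q_op T s)"
    using s by (auto simp: S_resolvent_set_def linear_injective_0[OF Q.linear_axioms])
  from s have "\<exists>C. \<forall>y\<in>range (Q_op T s). norm (inv (Q_op T s) y) \<le> C * norm y"
    unfolding S_resolvent_set_def by (elim CollectE conjE)
  then obtain C where C: "\<forall>y\<in>range (Q_op T s). norm (inv (Q_op T s) y) \<le> C * norm y" ..
  \<comment> \<open>The existential constant \<open>C\<close> may be zero or negative, hence the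
    absolute value and the added 1.\<close>
  define c where "c = 1 / (\<bar>C\<bar> + 1)"
  have c: "0 < c" by (simp add: c_def)
  have Q_ge: "c * norm x \<le> norm (Q_op T s x)" for x
  proof -
    have "norm x \<le> C * norm (Q_op T s x)"
      using bspec[OF C rangeI[of _ x]] inj by simp
    also have "\<dots> \<le> (\<bar>C\<bar> + 1) * norm (Q_op T s x)"
      by (intro mult_right_mono) auto
    finally show ?thesis
      by (simp add: c_def field_simps)
  qed
  have "surj (Q_op T s)"
    using s by (intro surj_if_bounded_below_dense_range[OF Q c Q_ge]) (simp add: S_resolvent_set_def)
  with Q c Q_ge show "\<exists>c. surj_expanding c (Q_op T s)"
    by (auto simp: surj_expanding_def)
next
  fix c
  assume s: "s \<in> paravectors" and c: "surj_expanding c (Q_op T s)"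
  interpret Q: bounded_linear "Q_op T s" using c by (simp add: surj_expanding_def)
  have "inj (Q_op T s)" "surj (Q_op T s)"
    using surj_expanding_bij[OF c] by (auto simp: bij_def)
  moreover have "norm (inv (Q_op T s) y) \<le> 1 / c * norm y" for y
    using surj_expanding_norm_inv_le[OF c, of y] by simp
  ultimately show "s \<in> S_resolvent_set T"
    using s unfolding S_resolvent_set_def
    by (intro CollectI conjI exI[of _ "1 / c"] ballI) (auto simp: linear_injective_0[OF Q.linear_axioms] Q.zero)
qed

text \<open>Moving \<open>s\<close> perturbs \<open>Q_op T s\<close> by an operator of small norm.
  Openness holds in the whole algebra; the restriction to paravectors comes later.\<close>

lemma open_surj_expanding_Q_op: "open {s. \<exists>c. surj_expanding c (Q_op T s)}"
proof (rule openI, safe)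
  fix s c
  assume c: "surj_expanding c (Q_op T s)"
  \<comment> \<open>\<open>d t\<close> bounds the norm of the difference of \<open>Q_op T t\<close>
    and \<open>Q_op T s\<close>; it is continuous in \<open>t\<close> and vanishes at
    \<open>s\<close>.\<close>
  define d where "d t = 2 * \<bar>cl_Re t - cl_Re s\<bar> * onorm T + \<bar>(norm t)\<^sup>2 - (norm s)\<^sup>2\<bar>" for t :: "real ^ 'n set"
  have "open {t. d t < c}"
    unfolding d_def cl_Re_def by (intro open_Collect_less continuous_intros)
  moreover have "d s < c"
    using c by (simp add: d_def surj_expanding_def)
  ultimately obtain e where e: "0 < e" "ball s e \<subseteq> {t. d t < c}"
    by (metis (mono_tags) mem_Collect_eq openE)
  have "\<exists>c. surj_expanding c (Q_op T t)" if "t \<in> ball s e" for t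
  proof -
    define P where "P x = ((norm t)\<^sup>2 - (norm s)\<^sup>2) *\<^sub>R x - (2 * (cl_Re t - cl_Re s)) *\<^sub>R T x" for x
    have "bounded_linear P"
      unfolding P_def by (intro bounded_linear_intros T)
    moreover have "norm (P x) \<le> d t * norm x" for x
    proof -
      have "norm (P x) \<le> \<bar>(norm t)\<^sup>2 - (norm s)\<^sup>2\<bar> * norm x + 2 * \<bar>cl_Re t - cl_Re s\<bar> * norm (T x)"
        unfolding P_def by (rule order_trans[OF norm_triangle_ineq4]) (simp add: abs_mult del: right_diff_distrib_numeral)
      also have "\<dots> \<le> \<bar>(norm t)\<^sup>2 - (norm s)\<^sup>2\<bar> * norm x + 2 * \<bar>cl_Re t - cl_Re s\<bar> * (onorm T * norm x)"
        by (intro add_left_mono mult_left_mono onorm T) auto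
      finally show ?thesis by (simp add: d_def algebra_simps)
    qed
    moreover have "0 \<le> d t"
      using onorm_pos_le[OF T] by (simp add: d_def)
    ultimately have "surj_expanding (c - d t) (\<lambda>x. Q_op T s x + P x)"
      using that e by (intro surj_expanding_perturb[OF c]) auto
    moreover have "(\<lambda>x. Q_op T s x + P x) = Q_op T t"
      by (simp add: Q_op_def P_def fun_eq_iff algebra_simps)
    ultimately show ?thesis by auto
  qed
  with e(1) show "\<exists>e>0. ball s e \<subseteq> {s. \<exists>c. surj_expanding c (Q_op T s)}"
    by blast
qed

end

theorem theorem3p1p8:
  fixes T :: "'h::{real_inner, complete_space} ^ 'n::{finite, linorder} set \<Rightarrow> 'h ^ 'n set"
  assumes "\<exists>u :: 'h. u \<noteq> 0"
    and "T \<in> clifford_bounded_ops"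
  shows "S_spectrum T \<noteq> {} \<and> compact (S_spectrum T) \<and>
         S_spectrum T \<subseteq> {s \<in> paravectors. 0 \<le> norm s \<and> norm s \<le> onorm T}"
proof -
  have T: "bounded_linear T"
    using assms(2) by (simp add: clifford_bounded_ops_def)
  have spectrum: "S_spectrum T = paravectors - {s. \<exists>c. surj_expanding c (Q_op T s)}"
    by (auto simp: S_spectrum_def S_resolvent_set_iff[OF T])
  have subset: "S_spectrum T \<subseteq> {s \<in> paravectors. 0 \<le> norm s \<and> norm s \<le> onorm T}"
  proof
    fix s assume s: "s \<in> S_spectrum T"
    obtain z where z: "Re z = cl_Re s" "cmod z = norm s"
      using ex_complex_Re_norm by blast
    then have "\<not> onorm T < cmod z"
      using s surj_expanding_quad_op_large[OF T, of z] by (auto simp: spectrum Q_op_eq_quad_op)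
    with s z show "s \<in> {s \<in> paravectors. 0 \<le> norm s \<and> norm s \<le> onorm T}"
      by (simp add: spectrum)
  qed
  have "closed (S_spectrum T)"
    unfolding spectrum
    by (intro closed_Diff closed_subspace subspace_paravectors open_surj_expanding_Q_op T)
  moreover have "bounded (S_spectrum T)"
    using subset by (auto simp: bounded_iff)
  ultimately have "compact (S_spectrum T)"
    by (simp add: compact_eq_bounded_closed)
  moreover have "S_spectrum T \<noteq> {}"
  proof -
    obtain u :: 'h where "u \<noteq> 0" using assms(1) by blast
    then have "\<exists>x :: 'h ^ 'n set. x \<noteq> 0"
      by (intro exI[of _ "axis {} u"]) (simp add: axis_eq_0_iff)
    then obtain z where z: "\<And>c. \<not> surj_expanding c (cshift T z)"
      using ex_not_surj_expanding_cshift[OF T] by blast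
    \<comment> \<open>A paravector matching \<open>z\<close> has
      \<open>Q_op T s = quad_op T z\<close>; were this invertible, so would be its factor
      \<open>cshift T z\<close>.\<close>
    obtain s :: "real ^ 'n set" where s: "s \<in> paravectors" "cl_Re s = Re z" "norm s = cmod z"
      using ex_paravector_Re_norm by blast
    have "\<not> surj_expanding c (Q_op T s)" for c
      using z surj_expanding_cshift_if_quad_op[OF T] s Q_op_eq_quad_op[of z s T] by auto
    with s have "s \<in> S_spectrum T" by (simp add: spectrum)
    then show ?thesis by blast
  qed
  ultimately show ?thesis using subset by blast
qed

end
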